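(* Let $1<p,q<\infty$, let $u,v$ be weights on $\mathbf{R}^n$, and consider the following statements. (i) There is a constant $C$ such that $\left(\int_{\mathbf{R}^n} |\widehat f|^q\, u\right)^{1/q}\leq C\left(\int_{\mathbf{R}^n} |f|^p\,v\right)^{1/p}$ for all $f\in L^1(\mathbf{R}^n)$. (ii) There is a constant $C$ such that for all bounded, measurable sets $E\subset\mathbf{R}^n$, all $-\mu\in E$, and all $\tau\in\mathbf{R}^n$, $$\left(\int_{(E+\mu)^\circ+\tau} |\widehat f|^q\, u\right)^{1/q}\leq C\left(\int_E |f|^p\,v\right)^{1/p}\quad\text{for all } f\in L^1 \text{ supported in } E,$$ and $$\left(\int_{E} |\widehat f|^q\, u\right)^{1/q}\leq C\left(\int_{(E+\mu)^\circ+\tau} |f|^p\,v\right)^{1/p}\quad\text{for all } f\in L^1 \text{ supported in } (E+\mu)^\circ+\tau.$$ (iii) There is a constant $C$ such that for all bounded, measurable sets $E\subset\mathbf{R}^n$, all $-\mu\in E$, and all $\tau\in\mathbf{R}^n$, $$\left(\int_E f\right)\left(\int_{(E+\mu)^\circ+\tau} u\right)^{1/q}\leq C\left(\int_E f^p\,v\right)^{1/p}$$ for all nonnegative integrable functions $f$ supported in $E$, and $$\left(\int_{(E+\mu)^\circ+\tau} f\right)\left(\int_{E} u\right)^{1/q}\leq C\left(\int_{(E+\mu)^\circ+\tau} f^p\,v\right)^{1/p}$$ for all nonnegative integrable functions $f$ supported in $(E+\mu)^\circ+\tau$. (iv) There is a constant $C$ such that for all bounded, measurable sets $E\subset\mathbf{R}^n$,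 all $-\mu\in E$, and all $\tau\in\mathbf{R}^n$, $$\left(\int_{(E+\mu)^\circ+\tau} u\right)^{1/q}\left( \int_E v^{-p'/p}\right)^{1/p'} \leq C \quad\text{and}\quad \left(\int_{E} u\right)^{1/q}\left( \int_{(E+\mu)^\circ+\tau} v^{-p'/p}\right)^{1/p'} \leq C.$$ Then (i) $\Rightarrow$ (ii), and (i) $\Rightarrow$ (iii) $\Leftrightarrow$ (iv) $\Rightarrow$ (ii).
   Context: A weight is a nonnegative, locally integrable function on $\mathbf{R}^n$. Here $p'=p/(p-1)$, and $w=v^{-p'/p}$ is assumed to be locally integrable. The Fourier transform is $\widehat f(z)=\int_{\mathbf{R}^n} f(x)e^{-ix\cdot z}\,dx$. For a bounded set $A\subset\mathbf{R}^n$ containing the origin, its polar is $A^\circ=\{z\in\mathbf{R}^n: |x\cdot z|\le 1\text{ for all }x\in A\}$. For $-\mu\in E$ the set $E+\mu$ contains the origin, and $(E+\mu)^\circ+\tau$ denotes the translate by $\tau$ of the polar of $E+\mu$. The usual measure-theoretic convention $0\cdot\infty=0$ is used. *)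

theory Defs
  imports "HOL-Analysis.Analysis"
begin

text \<open>
  Real powers on \<open>[0,\<infinity>]\<close>. In contrast to \<^const>\<open>powr\<close> on the reals, where \<open>0 powr a = 0\<close> for
  every \<open>a\<close>, negative powers of \<open>0\<close> are \<open>\<infinity>\<close> here.
\<close>

definition epowr :: "ennreal \<Rightarrow> real \<Rightarrow> ennreal"  (infixr \<open>epowr\<close> 80) where
  "x epowr a =
     (if a = 0 then 1
      else if x = 0 then (if a > 0 then 0 else \<infinity>)
      else if x = \<infinity> then (if a > 0 then \<infinity> else 0)
      else ennreal (enn2real x powr a))"

definition locally_integrable :: "(real ^ 'n \<Rightarrow> ennreal) \<Rightarrow> bool" where
  "locally_integrable g \<longleftrightarrow>
     g \<in> borel_measurable lebesgue \<and>
     (\<forall>K. compact K \<longrightarrow> (\<integral>\<^sup>+x\<in>K. g x \<partial>lebesgue) < \<infinity>)"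

definition weight :: "(real ^ 'n \<Rightarrow> real) \<Rightarrow> bool" where
  "weight u \<longleftrightarrow> (\<forall>x. 0 \<le> u x) \<and> locally_integrable (\<lambda>x. ennreal (u x))"

definition conj_exp :: "real \<Rightarrow> real" where
  "conj_exp p = p / (p - 1)"

text \<open>The function \<open>v\<^bsup>-p'/p\<^esup>\<close>, which is \<open>\<infinity>\<close> where \<open>v\<close> vanishes.\<close>

definition dual_weight :: "real \<Rightarrow> (real ^ 'n \<Rightarrow> real) \<Rightarrow> real ^ 'n \<Rightarrow> ennreal" where
  "dual_weight p v x = ennreal (v x) epowr (- (conj_exp p / p))"

definition fourier :: "(real ^ 'n \<Rightarrow> complex) \<Rightarrow> real ^ 'n \<Rightarrow> complex" where
  "fourier f z = (LINT x|lebesgue. f x * exp (- \<i> * complex_of_real (x \<bullet> z)))"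

definition polar :: "(real ^ 'n) set \<Rightarrow> (real ^ 'n) set" where
  "polar A = {z. \<forall>x\<in>A. \<bar>x \<bullet> z\<bar> \<le> 1}"

text \<open>The translated polar \<open>(E + \<mu>)\<degree> + \<tau>\<close>.\<close>

definition polar_translate ::
    "(real ^ 'n) set \<Rightarrow> real ^ 'n \<Rightarrow> real ^ 'n \<Rightarrow> (real ^ 'n) set" where
  "polar_translate E \<mu> \<tau> = (\<lambda>z. z + \<tau>) ` polar ((\<lambda>x. x + \<mu>) ` E)"

definition supported_in :: "(real ^ 'n \<Rightarrow> 'b::zero) \<Rightarrow> (real ^ 'n) set \<Rightarrow> bool" where
  "supported_in f A \<longleftrightarrow> (AE x in lebesgue. x \<notin> A \<longrightarrow> f x = 0)"

text \<open>\<open>(\<integral>\<^bsub>A\<^esub> |g|\<^bsup>r\<^esup> u)\<^bsup>1/r\<^esup>\<close>, with values in \<open>[0,\<infinity>]\<close>.\<close>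

definition weighted_norm ::
    "real \<Rightarrow> (real ^ 'n \<Rightarrow> real) \<Rightarrow> (real ^ 'n) set \<Rightarrow>
       (real ^ 'n \<Rightarrow> 'b::real_normed_vector) \<Rightarrow> ennreal" where
  "weighted_norm r u A g =
     (\<integral>\<^sup>+x\<in>A. ennreal (norm (g x) powr r * u x) \<partial>lebesgue) epowr (1 / r)"

definition fourier_ineq ::
    "real \<Rightarrow> real \<Rightarrow> (real ^ 'n \<Rightarrow> real) \<Rightarrow> (real ^ 'n \<Rightarrow> real) \<Rightarrow> bool" where
  "fourier_ineq p q u v \<longleftrightarrow>
     (\<exists>C::real. 0 \<le> C \<and>
       (\<forall>f :: real ^ 'n \<Rightarrow> complex. integrable lebesgue f \<longrightarrow>
          weighted_norm q u UNIV (fourier f) \<le> ennreal C * weighted_norm p v UNIV f))"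

definition local_fourier_ineq ::
    "real \<Rightarrow> real \<Rightarrow> (real ^ 'n \<Rightarrow> real) \<Rightarrow> (real ^ 'n \<Rightarrow> real) \<Rightarrow> bool" where
  "local_fourier_ineq p q u v \<longleftrightarrow>
     (\<exists>C::real. 0 \<le> C \<and>
       (\<forall>E \<mu> \<tau>. bounded E \<and> E \<in> sets lebesgue \<and> - \<mu> \<in> E \<longrightarrow>
          (\<forall>f :: real ^ 'n \<Rightarrow> complex.
             integrable lebesgue f \<and> supported_in f E \<longrightarrow>
             weighted_norm q u (polar_translate E \<mu> \<tau>) (fourier f)
               \<le> ennreal C * weighted_norm p v E f) \<and>
          (\<forall>f :: real ^ 'n \<Rightarrow> complex.
             integrable lebesgue f \<and> supported_in f (polar_translate E \<mu> \<tau>) \<longrightarrow>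
             weighted_norm q u E (fourier f)
               \<le> ennreal C * weighted_norm p v (polar_translate E \<mu> \<tau>) f)))"

definition mean_ineq ::
    "real \<Rightarrow> real \<Rightarrow> (real ^ 'n \<Rightarrow> real) \<Rightarrow> (real ^ 'n \<Rightarrow> real) \<Rightarrow> bool" where
  "mean_ineq p q u v \<longleftrightarrow>
     (\<exists>C::real. 0 \<le> C \<and>
       (\<forall>E \<mu> \<tau>. bounded E \<and> E \<in> sets lebesgue \<and> - \<mu> \<in> E \<longrightarrow>
          (\<forall>f :: real ^ 'n \<Rightarrow> real.
             (\<forall>x. 0 \<le> f x) \<and> integrable lebesgue f \<and> supported_in f E \<longrightarrow>
             (\<integral>\<^sup>+x\<in>E. ennreal (f x) \<partial>lebesgue)
                 * (\<integral>\<^sup>+x\<in>polar_translate E \<mu> \<tau>. ennreal (u x) \<partial>lebesgue) epowr (1 / q)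
               \<le> ennreal C * (\<integral>\<^sup>+x\<in>E. ennreal (f x powr p * v x) \<partial>lebesgue) epowr (1 / p)) \<and>
          (\<forall>f :: real ^ 'n \<Rightarrow> real.
             (\<forall>x. 0 \<le> f x) \<and> integrable lebesgue f \<and>
             supported_in f (polar_translate E \<mu> \<tau>) \<longrightarrow>
             (\<integral>\<^sup>+x\<in>polar_translate E \<mu> \<tau>. ennreal (f x) \<partial>lebesgue)
                 * (\<integral>\<^sup>+x\<in>E. ennreal (u x) \<partial>lebesgue) epowr (1 / q)
               \<le> ennreal C *
                  (\<integral>\<^sup>+x\<in>polar_translate E \<mu> \<tau>. ennreal (f x powr p * v x) \<partial>lebesgue)
                    epowr (1 / p))))"

definition muckenhoupt_polar ::
    "real \<Rightarrow> real \<Rightarrow> (real ^ 'n \<Rightarrow> real) \<Rightarrow> (real ^ 'n \<Rightarrow> real) \<Rightarrow> bool" where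
  "muckenhoupt_polar p q u v \<longleftrightarrow>
     (\<exists>C::real. 0 \<le> C \<and>
       (\<forall>E \<mu> \<tau>. bounded E \<and> E \<in> sets lebesgue \<and> - \<mu> \<in> E \<longrightarrow>
          (\<integral>\<^sup>+x\<in>polar_translate E \<mu> \<tau>. ennreal (u x) \<partial>lebesgue) epowr (1 / q)
              * (\<integral>\<^sup>+x\<in>E. dual_weight p v x \<partial>lebesgue) epowr (1 / conj_exp p)
            \<le> ennreal C \<and>
          (\<integral>\<^sup>+x\<in>E. ennreal (u x) \<partial>lebesgue) epowr (1 / q)
              * (\<integral>\<^sup>+x\<in>polar_translate E \<mu> \<tau>. dual_weight p v x \<partial>lebesgue)
                  epowr (1 / conj_exp p)
            \<le> ennreal C))"

end

theory Submission
  imports Defs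
begin

section \<open>Powers on the extended half-line\<close>

text \<open>Write B for the translated polar of E. For x in E and z in B the number (x + \<mu>)
  \<bullet> (z - \<tau>) lies in [-1, 1] (\<open>polar_translate_inner_le\<close>), a relation
  symmetric in the two sets. If f \<ge> 0 is supported in E and is modulated by the character of
  frequency \<tau>, its Fourier transform at z in B is, up to a unimodular factor, the integral of f
  times exp(-i (x + \<mu>) \<bullet> (z - \<tau>)). The real part of the integrand is at least cos 1
  times f, so no cancellation occurs and the transform has modulus at least cos 1 times the integral
  of f on all of B (\<open>norm_fourier_modulated_ge\<close>). Since modulation does not change |f|,
  inserting this into (i) gives (iii) with \<open>C / cos 1\<close>
  (\<open>fourier_ineq_imp_mean\<close>); exchanging the sets gives the other half.

  (iii) and (iv) are dual forms of one statement about a single set, with the same constant: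
  Hoelder's inequality gives one direction, and testing on truncations of the extremal function
  v^(-p'/p) gives the other (\<open>mean_ineq_iff_dual_weight\<close>). Finally (ii) follows from
  (iii) by the trivial bound of the transform by the integral of |f|
  (\<open>mean_imp_fourier\<close>), and from (i) by restricting to sets.\<close>

lemma epowr_ennreal:
  assumes "0 \<le> x" "0 < a"
  shows "ennreal x epowr a = ennreal (x powr a)"
  using assms by (auto simp: epowr_def)

lemma zero_epowr: "0 < a \<Longrightarrow> 0 epowr a = 0"
  by (simp add: epowr_def)

lemma top_epowr: "0 < a \<Longrightarrow> top epowr a = top"
  by (simp add: epowr_def)

lemma epowr_mono:
  assumes "x \<le> y" "0 < a"
  shows "x epowr a \<le> y epowr a"
proof (cases y rule: ennreal_cases)
  case (real s)
  then obtain r where "x = ennreal r" "0 \<le> r"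
    using assms by (cases x rule: ennreal_cases) (auto simp: top_unique)
  then show ?thesis
    using real assms by (simp add: epowr_ennreal powr_mono2)
qed (use assms in \<open>simp add: top_epowr\<close>)

text \<open>For a positive exponent the rule survives 0 * \<infinity> = 0, since both sides then
  vanish. Otherwise an infinite factor meets a nonzero one, before and after taking powers, and both
  sides are infinite.\<close>

lemma mult_epowr:
  assumes "0 < a"
  shows "(x * y) epowr a = x epowr a * y epowr a"
proof -
  consider "x = 0" | "y = 0" | "x \<noteq> 0" "y \<noteq> 0" "x = top \<or> y = top"
    | r s where "x = ennreal r" "y = ennreal s" "0 \<le> r" "0 \<le> s"
    by (cases x rule: ennreal_cases; cases y rule: ennreal_cases) auto
  then show ?thesis
  proof cases
    case 3
    then have "x epowr a \<noteq> 0" "y epowr a \<noteq> 0"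
      using assms by (auto simp: epowr_def enn2real_eq_0_iff)
    with 3 show ?thesis
      using assms by (auto simp: top_epowr ennreal_mult_top ennreal_top_mult)
  next
    case 4
    then show ?thesis
      using assms by (simp add: epowr_ennreal powr_mult flip: ennreal_mult)
  qed (use assms in \<open>simp_all add: zero_epowr\<close>)
qed

lemma epowr_epowr:
  assumes "0 < a" "0 < b"
  shows "(x epowr a) epowr b = x epowr (a * b)"
  using assms by (cases x rule: ennreal_cases) (auto simp: epowr_ennreal top_epowr powr_powr)

lemma epowr_one: "x epowr 1 = x"
  by (cases x rule: ennreal_cases) (auto simp: epowr_ennreal top_epowr)

lemma epowr_le_epowr_iff:
  assumes "0 < a"
  shows "x epowr a \<le> y epowr a \<longleftrightarrow> x \<le> y"
proof
  assume "x epowr a \<le> y epowr a"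
  then have "(x epowr a) epowr (1 / a) \<le> (y epowr a) epowr (1 / a)"
    by (rule epowr_mono) (use assms in simp)
  then show "x \<le> y"
    using assms by (simp add: epowr_epowr epowr_one)
qed (use assms epowr_mono in blast)

text \<open>Moving \<open>K\<close> under the power as \<open>K epowr (1 / s)\<close> and taking
  \<open>s\<close>-th roots makes the bound linear in \<open>W n\<close>, where suprema commute with
  multiplication. It serves to pass from truncations to a whole set; \<open>K\<close> may be
  infinite.\<close>

lemma mult_SUP_epowr_le:
  fixes W :: "nat \<Rightarrow> ennreal"
  assumes "0 < s" and le: "\<And>n. K * W n epowr s \<le> C"
  shows "K * (SUP n. W n) epowr s \<le> C"
proof -
  let ?K = "K epowr (1 / s)"
  have eq: "K * x epowr s = (?K * x) epowr s" for x
    using assms by (simp add: mult_epowr epowr_epowr epowr_one)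
  have C: "C = (C epowr (1 / s)) epowr s"
    using assms by (simp add: epowr_epowr epowr_one)
  have "?K * W n \<le> C epowr (1 / s)" for n
    using le[of n] C assms(1) by (metis eq epowr_le_epowr_iff)
  then have "?K * (SUP n. W n) \<le> C epowr (1 / s)"
    by (simp add: SUP_mult_left_ennreal SUP_least)
  then show ?thesis
    using assms(1) C by (metis eq epowr_le_epowr_iff)
qed

section \<open>Hoelder's inequality\<close>

lemma conj_exp:
  assumes "1 < p"
  shows "1 < conj_exp p" "1 / p + 1 / conj_exp p = 1"
  using assms by (auto simp: conj_exp_def field_simps)

text \<open>Young's inequality, applied pointwise after both functions are scaled to norm one.
  Values in [0, \<infinity>] allow infinite norms, which are treated separately.\<close>

lemma nn_integral_Hoelder:
  fixes a b :: "'a \<Rightarrow> real"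
  assumes [measurable]: "a \<in> borel_measurable M" "b \<in> borel_measurable M"
    and a: "\<And>x. 0 \<le> a x" and b: "\<And>x. 0 \<le> b x" and p: "1 < p"
  defines "q \<equiv> conj_exp p"
  shows "(\<integral>\<^sup>+x. ennreal (a x * b x) \<partial>M)
    \<le> (\<integral>\<^sup>+x. ennreal (a x powr p) \<partial>M) epowr (1 / p)
      * (\<integral>\<^sup>+x. ennreal (b x powr q) \<partial>M) epowr (1 / q)"
    (is "?I \<le> ?A epowr _ * ?B epowr _")
proof -
  have q: "1 < q" and pq: "1 / p + 1 / q = 1"
    using conj_exp[OF p] by (auto simp: q_def)
  have null: "?I = 0" if "AE x in M. a x * b x = 0"
  proof -
    have "?I = (\<integral>\<^sup>+x. 0 \<partial>M)"
      by (rule nn_integral_cong_AE) (use that in \<open>auto elim: eventually_mono\<close>)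
    then show ?thesis by simp
  qed
  \<comment> \<open>A vanishing norm takes precedence over an infinite one: since 0 * \<infinity> =
    0, the right side is then 0, and the left side must be shown to vanish too.\<close>
  consider "?A = 0" | "?B = 0" | "?A \<noteq> 0" "?B \<noteq> 0" "?A = top \<or> ?B = top"
    | P Q where "?A = ennreal P" "?B = ennreal Q" "0 < P" "0 < Q"
    by (cases ?A rule: ennreal_cases; cases ?B rule: ennreal_cases) (force simp: less_le)+
  then show ?thesis
  proof cases
    case 1
    then have "AE x in M. a x powr p \<le> 0"
      by (subst (asm) nn_integral_0_iff_AE) (auto simp: ennreal_eq_0_iff)
    then have "?I = 0"
      by (intro null) (auto elim!: eventually_mono)
    then show ?thesis by simp
  next
    case 2
    then have "AE x in M. b x powr q \<le> 0"
      by (subst (asm) nn_integral_0_iff_AE) (auto simp: ennreal_eq_0_iff)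
    then have "?I = 0"
      by (intro null) (auto elim!: eventually_mono)
    then show ?thesis by simp
  next
    case 3
    then have "?A epowr (1 / p) \<noteq> 0" "?B epowr (1 / q) \<noteq> 0"
      using p q by (auto simp: epowr_def enn2real_eq_0_iff)
    with 3 have "?A epowr (1 / p) * ?B epowr (1 / q) = top"
      using p q by (auto simp: top_epowr ennreal_mult_top ennreal_top_mult)
    then show ?thesis by simp
  next
    case 4
    define s t where "s = P powr (1 / p)" and "t = Q powr (1 / q)"
    have st: "0 < s" "0 < t" "s powr p = P" "t powr q = Q"
      using 4 p q by (auto simp: s_def t_def powr_powr)
    \<comment> \<open>\<open>s\<close> and \<open>t\<close> are the two norms; dividing by them
      gives functions whose Young bound integrates to 1 / p + 1 / q = 1.\<close>
    have "a x * b x \<le> s * t * (a x powr p / (p * P) + b x powr q / (q * Q))" for x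
    proof -
      have "(a x / s) * (b x / t) \<le> (a x / s) powr p / p + (b x / t) powr q / q"
        using a b st by (intro Youngs_inequality p q pq) (auto intro: divide_nonneg_nonneg)
      also have "\<dots> = a x powr p / (p * P) + b x powr q / (q * Q)"
        using st a[of x] b[of x] by (simp add: powr_divide mult.commute)
      finally show ?thesis
        using st by (simp add: field_simps)
    qed
    then have "?I \<le> (\<integral>\<^sup>+x. ennreal (s * t)
        * (ennreal (1 / (p * P)) * ennreal (a x powr p)
          + ennreal (1 / (q * Q)) * ennreal (b x powr q)) \<partial>M)"
      using st 4 p q
      by (intro nn_integral_mono)
        (simp flip: ennreal_mult ennreal_plus add: ennreal_leI)
    also have "\<dots> = ennreal (s * t) * (ennreal (1 / (p * P)) * ?A + ennreal (1 / (q * Q)) * ?B)"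
      by (simp add: nn_integral_cmult nn_integral_add)
    also have "\<dots> = ennreal (s * t * (1 / p + 1 / q))"
      using 4 st p q by (simp flip: ennreal_mult ennreal_plus)
    also have "\<dots> = ?A epowr (1 / p) * ?B epowr (1 / q)"
      using 4 p q st by (simp add: pq epowr_ennreal s_def t_def flip: ennreal_mult)
    finally show ?thesis .
  qed
qed

section \<open>Weights\<close>

lemma weight_nonneg: "weight u \<Longrightarrow> 0 \<le> u x"
  by (simp add: weight_def)

lemma weight_measurable:
  assumes "weight u"
  shows "u \<in> borel_measurable lebesgue"
proof -
  have "(\<lambda>x. enn2real (ennreal (u x))) \<in> borel_measurable lebesgue"
    using assms by (intro borel_measurable_enn2real) (simp add: weight_def locally_integrable_def)
  then show ?thesis
    using assms by (simp add: weight_def)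
qed

lemma cball_sets_lebesgue [measurable]: "cball a r \<in> sets lebesgue"
  by (rule fmeasurableD[OF lmeasurable_cball])

text \<open>A finite integral over a ball forces finiteness almost everywhere in it, and countably
  many balls cover the space.\<close>

lemma locally_integrable_AE_finite:
  assumes "locally_integrable g"
  shows "AE x in lebesgue. g x \<noteq> \<infinity>"
proof -
  have [measurable]: "g \<in> borel_measurable lebesgue"
    using assms by (simp add: locally_integrable_def)
  have "AE x in lebesgue. g x * indicator (cball 0 (real n)) x \<noteq> \<infinity>" for n
    using assms by (intro nn_integral_PInf_AE) (measurable, auto simp: locally_integrable_def less_top)
  then have "AE x in lebesgue. \<forall>n. g x * indicator (cball 0 (real n)) x \<noteq> \<infinity>"
    by (simp add: AE_all_countable)
  then show ?thesis
  proof (rule eventually_mono)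
    fix x
    assume *: "\<forall>n. g x * indicator (cball 0 (real n)) x \<noteq> \<infinity>"
    obtain n :: nat where "norm x \<le> real n"
      using real_arch_simple by blast
    then show "g x \<noteq> \<infinity>"
      using *[rule_format, of n] by simp
  qed
qed

lemma dual_weight_pos:
  assumes "1 < p" "0 < v x"
  shows "dual_weight p v x = ennreal (v x powr (- (conj_exp p / p)))"
  using assms conj_exp(1)[of p] by (auto simp: dual_weight_def epowr_def)

lemma dual_weight_zero:
  assumes "1 < p" "v x = 0"
  shows "dual_weight p v x = \<infinity>"
proof -
  have "0 < conj_exp p / p"
    using assms(1) conj_exp(1)[of p] by simp
  then show ?thesis
    using assms(2) by (auto simp: dual_weight_def epowr_def)
qed

text \<open>The dual weight is infinite wherever \<open>v\<close> vanishes, so its local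
  integrability makes the zero set of \<open>v\<close> null. This permits negative real powers of
  \<open>v\<close> under integrals.\<close>

lemma AE_weight_pos:
  assumes "1 < p" "weight v" "locally_integrable (dual_weight p v)"
  shows "AE x in lebesgue. 0 < v x"
  using locally_integrable_AE_finite[OF assms(3)]
proof (rule eventually_mono)
  fix x
  assume "dual_weight p v x \<noteq> \<infinity>"
  then have "v x \<noteq> 0"
    using dual_weight_zero[of p v x] assms(1) by blast
  then show "0 < v x"
    using weight_nonneg[OF assms(2), of x] by simp
qed

section \<open>Duality between weighted means and the dual weight\<close>

text \<open>Hoelder's inequality for the splitting f = (f v^(1/p)) v^(-1/p); the p'-th power of the
  second factor is the dual weight.\<close>

lemma mean_le_dual_weight:
  fixes f :: "real ^ 'n \<Rightarrow> real"
  assumes p: "1 < p" and v: "weight v" and w: "locally_integrable (dual_weight p v)"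
    and [measurable]: "A \<in> sets lebesgue" "f \<in> borel_measurable lebesgue" and f: "\<And>x. 0 \<le> f x"
  shows "(\<integral>\<^sup>+x\<in>A. ennreal (f x) \<partial>lebesgue)
    \<le> (\<integral>\<^sup>+x\<in>A. ennreal (f x powr p * v x) \<partial>lebesgue) epowr (1 / p)
      * (\<integral>\<^sup>+x\<in>A. dual_weight p v x \<partial>lebesgue) epowr (1 / conj_exp p)"
proof -
  note [measurable] = weight_measurable[OF v]
  define a where "a x = f x * v x powr (1 / p) * indicator A x" for x
  define b where "b x = v x powr (- (1 / p)) * indicator A x" for x
  have [measurable]: "a \<in> borel_measurable lebesgue" "b \<in> borel_measurable lebesgue"
    unfolding a_def b_def by measurable
  have vpos: "AE x in lebesgue. 0 < v x"
    by (rule AE_weight_pos[OF p v w])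
  \<comment> \<open>Where \<open>v\<close> vanishes, \<open>powr\<close> makes both factors 0 and
    the product loses \<open>f\<close>; this happens only on a null set.\<close>
  have ab: "(\<integral>\<^sup>+x. ennreal (a x * b x) \<partial>lebesgue) = (\<integral>\<^sup>+x\<in>A. ennreal (f x) \<partial>lebesgue)"
    by (rule nn_integral_cong_AE, use vpos in eventually_elim)
      (auto simp: a_def b_def indicator_def powr_minus field_simps)
  have aa: "(\<integral>\<^sup>+x. ennreal (a x powr p) \<partial>lebesgue)
      = (\<integral>\<^sup>+x\<in>A. ennreal (f x powr p * v x) \<partial>lebesgue)"
    by (rule nn_integral_cong_AE, use vpos in eventually_elim)
      (use p f in \<open>auto simp: a_def indicator_def powr_mult powr_powr\<close>)
  have bb: "(\<integral>\<^sup>+x. ennreal (b x powr conj_exp p) \<partial>lebesgue)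
      = (\<integral>\<^sup>+x\<in>A. dual_weight p v x \<partial>lebesgue)"
    by (rule nn_integral_cong_AE, use vpos in eventually_elim)
      (use p in \<open>auto simp: b_def indicator_def powr_powr dual_weight_pos\<close>)
  show ?thesis
    using nn_integral_Hoelder[of a lebesgue b p] p f
    by (simp add: ab aa bb) (simp add: a_def b_def)
qed

text \<open>Equality in Hoelder's inequality is attained at \<open>v\<^bsup>-p'/p\<^esup>\<close>; as \<open>A\<close> may be unbounded, this
  extremal function is truncated to balls to make it integrable.\<close>

lemma mean_ineq_iff_dual_weight:
  fixes v :: "real ^ 'n \<Rightarrow> real"
  assumes p: "1 < p" and v: "weight v" and w: "locally_integrable (dual_weight p v)"
    and [measurable]: "A \<in> sets lebesgue"
  shows "(\<forall>f :: real ^ 'n \<Rightarrow> real. (\<forall>x. 0 \<le> f x) \<and> integrable lebesgue f \<and> supported_in f A \<longrightarrow>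
      (\<integral>\<^sup>+x\<in>A. ennreal (f x) \<partial>lebesgue) * K
        \<le> ennreal C * (\<integral>\<^sup>+x\<in>A. ennreal (f x powr p * v x) \<partial>lebesgue) epowr (1 / p))
    \<longleftrightarrow> K * (\<integral>\<^sup>+x\<in>A. dual_weight p v x \<partial>lebesgue) epowr (1 / conj_exp p) \<le> ennreal C"
    (is "?L \<longleftrightarrow> ?R")
proof
  assume ?R
  show ?L
  proof (intro allI impI, elim conjE)
    fix f :: "real ^ 'n \<Rightarrow> real"
    assume f: "\<forall>x. 0 \<le> f x" "integrable lebesgue f"
    let ?N = "(\<integral>\<^sup>+x\<in>A. ennreal (f x powr p * v x) \<partial>lebesgue) epowr (1 / p)"
    let ?W = "(\<integral>\<^sup>+x\<in>A. dual_weight p v x \<partial>lebesgue) epowr (1 / conj_exp p)"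
    have "(\<integral>\<^sup>+x\<in>A. ennreal (f x) \<partial>lebesgue) * K \<le> (?N * ?W) * K"
      using f by (intro mult_right_mono mean_le_dual_weight[OF p v w]) auto
    also have "\<dots> = (K * ?W) * ?N"
      by (simp add: ac_simps)
    also have "\<dots> \<le> ennreal C * ?N"
      using \<open>?R\<close> by (rule mult_right_mono) simp
    finally show "(\<integral>\<^sup>+x\<in>A. ennreal (f x) \<partial>lebesgue) * K \<le> ennreal C * ?N" .
  qed
next
  assume L: ?L
  let ?p' = "conj_exp p"
  note [measurable] = weight_measurable[OF v]
  have [measurable]: "dual_weight p v \<in> borel_measurable lebesgue"
    using w by (simp add: locally_integrable_def)
  have p': "1 < ?p'" "1 / p + 1 / ?p' = 1"
    using conj_exp[OF p] by auto
  have vpos: "AE x in lebesgue. 0 < v x"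
    by (rule AE_weight_pos[OF p v w])
  define B where "B n = A \<inter> cball 0 (real n)" for n :: nat
  have [measurable]: "B n \<in> sets lebesgue" for n
    unfolding B_def by measurable
  define W where "W n = (\<integral>\<^sup>+x\<in>B n. dual_weight p v x \<partial>lebesgue)" for n
  have "K * W n epowr (1 / ?p') \<le> ennreal C" for n
  proof -
    \<comment> \<open>The real-valued form of the dual weight, cut off to \<open>B n\<close>. It is
      0 where \<open>v\<close> vanishes, whereas the dual weight is infinite there, so the two agree
      only almost everywhere.\<close>
    define f where "f x = v x powr (- (?p' / p)) * indicator (B n) x" for x
    have f0: "\<forall>x. 0 \<le> f x"
      by (simp add: f_def)
    have [measurable]: "f \<in> borel_measurable lebesgue"
      unfolding f_def by measurable
    have Wf: "(\<integral>\<^sup>+x. ennreal (f x) \<partial>lebesgue) = W n"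
      unfolding W_def by (rule nn_integral_cong_AE, use vpos in eventually_elim)
        (use p in \<open>auto simp: f_def indicator_def dual_weight_pos\<close>)
    have "W n \<le> (\<integral>\<^sup>+x\<in>cball 0 (real n). dual_weight p v x \<partial>lebesgue)"
      unfolding W_def by (intro nn_integral_mono) (auto simp: B_def indicator_def)
    also have "\<dots> < \<infinity>"
      using w by (simp add: locally_integrable_def)
    finally have Wfin: "W n < \<infinity>" .
    have int: "integrable lebesgue f"
      using Wf Wfin f0 by (intro integrableI_nonneg) auto
    have supp: "supported_in f A"
      by (auto simp: supported_in_def f_def B_def indicator_def)
    have "(\<integral>\<^sup>+x\<in>A. ennreal (f x) \<partial>lebesgue) = W n"
      unfolding Wf[symmetric] by (rule nn_integral_cong) (auto simp: f_def B_def indicator_def)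
    moreover have "(\<integral>\<^sup>+x\<in>A. ennreal (f x powr p * v x) \<partial>lebesgue) = W n"
      unfolding Wf[symmetric]
    proof (rule nn_integral_cong_AE, use vpos in eventually_elim)
      fix x
      assume "0 < v x"
      then have "(v x powr (- (?p' / p))) powr p * v x = v x powr (- (?p' / p) * p + 1)"
        by (simp only: powr_powr powr_add powr_one less_imp_le)
      \<comment> \<open>This exponent identity, 1 - p' = -p'/p, is why the extremal function has the
        same integral on both sides of the tested inequality.\<close>
      also have "- (?p' / p) * p + 1 = - (?p' / p)"
        using p by (simp add: conj_exp_def field_simps)
      finally have "(v x powr (- (?p' / p))) powr p * v x = v x powr (- (?p' / p))" .
      then show "ennreal (f x powr p * v x) * indicator A x = ennreal (f x)"
        using p by (auto simp: f_def B_def indicator_def)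
    qed
    ultimately have le: "W n * K \<le> ennreal C * W n epowr (1 / p)"
      using L[THEN spec, THEN mp, OF conjI[OF f0 conjI[OF int supp]]] by simp
    show ?thesis
    proof (cases "W n = 0")
      case True
      then show ?thesis
        using p' by (simp add: zero_epowr)
    next
      case False
      then obtain r where r: "W n = ennreal r" "0 < r"
        using Wfin by (cases "W n" rule: ennreal_cases) (auto simp: less_le)
      \<comment> \<open>Multiplying by \<open>?s\<close> divides the tested inequality by the p-th
        root of \<open>W n\<close>, which is positive and finite; the remaining exponent is 1 - 1/p
        = 1/p'. The factor \<open>K\<close>, possibly infinite, is never divided.\<close>
      let ?s = "ennreal (r powr (- (1 / p)))"
      have 1: "?s * W n = W n epowr (1 / ?p')"
      proof -
        have "1 / ?p' = - (1 / p) + 1"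
          using p'(2) by simp
        then have "r powr (1 / ?p') = r powr (- (1 / p)) * r"
          using r by (simp only: powr_add powr_one less_imp_le)
        then show ?thesis
          using r p' by (simp add: epowr_ennreal flip: ennreal_mult)
      qed
      have 2: "?s * W n epowr (1 / p) = 1"
        using r p by (simp add: epowr_ennreal flip: ennreal_mult powr_add)
      have "K * W n epowr (1 / ?p') = ?s * (W n * K)"
        by (simp add: 1[symmetric] ac_simps)
      also have "\<dots> \<le> ?s * (ennreal C * W n epowr (1 / p))"
        using le by (rule mult_left_mono) simp
      also have "\<dots> = ennreal C * (?s * W n epowr (1 / p))"
        by (simp add: ac_simps)
      finally show ?thesis
        by (simp add: 2)
    qed
  qed
  \<comment> \<open>The bound is uniform in \<open>n\<close>, so it passes to the supremum, which
    monotone convergence identifies with the integral over all of \<open>A\<close>.\<close>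
  then have "K * (SUP n. W n) epowr (1 / ?p') \<le> ennreal C"
    using p' by (intro mult_SUP_epowr_le) auto
  moreover have "(SUP n. W n) = (\<integral>\<^sup>+x\<in>A. dual_weight p v x \<partial>lebesgue)"
  proof -
    have "(SUP n. W n) = (\<integral>\<^sup>+x. (SUP n. dual_weight p v x * indicator (B n) x) \<partial>lebesgue)"
      unfolding W_def
      by (intro nn_integral_monotone_convergence_SUP[symmetric], simp_all)
        (auto simp: incseq_def le_fun_def B_def indicator_def)
    also have "\<dots> = (\<integral>\<^sup>+x\<in>A. dual_weight p v x \<partial>lebesgue)"
    proof (rule nn_integral_cong)
      fix x :: "real ^ 'n"
      obtain m :: nat where m: "norm x \<le> real m"
        using real_arch_simple by blast
      show "(SUP n. dual_weight p v x * indicator (B n) x) = dual_weight p v x * indicator A x"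
      proof (rule antisym)
        show "(SUP n. dual_weight p v x * indicator (B n) x) \<le> dual_weight p v x * indicator A x"
          by (rule SUP_least) (simp add: B_def indicator_def)
        show "dual_weight p v x * indicator A x \<le> (SUP n. dual_weight p v x * indicator (B n) x)"
          by (rule SUP_upper2[of m]) (simp_all add: B_def indicator_def m)
      qed
    qed
    finally show ?thesis .
  qed
  ultimately show ?R by simp
qed

section \<open>Local bounds for the Fourier transform\<close>

lemma closed_polar: "closed (polar A)"
proof -
  have "polar A = (\<Inter>x\<in>A. {z. \<bar>x \<bullet> z\<bar> \<le> 1})"
    by (auto simp: polar_def)
  then show ?thesis
    by (auto intro!: closed_INT closed_Collect_le continuous_intros)
qed

lemma polar_translate_sets [measurable]: "polar_translate E \<mu> \<tau> \<in> sets lebesgue"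
proof -
  have "closed ((\<lambda>z. \<tau> + z) ` polar ((\<lambda>x. x + \<mu>) ` E))"
    by (rule closed_translation[OF closed_polar])
  then show ?thesis
    by (simp add: polar_translate_def add.commute lebesgue_closedin)
qed

text \<open>This is how the geometry of polars enters the phase estimates. With the centres
  \<open>- \<mu>\<close> and \<open>\<tau>\<close> the bound is symmetric, so \<open>E\<close> and
  its translated polar may exchange roles.\<close>

lemma polar_translate_inner_le:
  assumes "x \<in> E" "z \<in> polar_translate E \<mu> \<tau>"
  shows "\<bar>(x - (- \<mu>)) \<bullet> (z - \<tau>)\<bar> \<le> 1"
  using assms by (auto simp: polar_translate_def polar_def)

lemma nn_integral_supported_in:
  assumes "supported_in f A" "\<And>x. f x = 0 \<Longrightarrow> g x = 0"
  shows "(\<integral>\<^sup>+x\<in>A. g x \<partial>lebesgue) = (\<integral>\<^sup>+x. g x \<partial>lebesgue)"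
  by (rule nn_integral_cong_AE, use assms(1)[unfolded supported_in_def] in eventually_elim)
    (auto simp: indicator_def assms(2))

lemma weighted_norm_supported_in:
  assumes "supported_in f A"
  shows "weighted_norm p v UNIV f = weighted_norm p v A f"
  using nn_integral_supported_in[OF assms, of "\<lambda>x. ennreal (norm (f x) powr p * v x)"]
  by (simp add: weighted_norm_def)

lemma weighted_norm_mono_set:
  assumes "A \<subseteq> B" "0 < r"
  shows "weighted_norm r u A g \<le> weighted_norm r u B g"
  unfolding weighted_norm_def using assms
  by (intro epowr_mono nn_integral_mono) (auto simp: indicator_def)

lemma weighted_norm_le_const:
  assumes "weight u" "0 < q" "A \<in> sets lebesgue" "0 \<le> c" "\<And>z. z \<in> A \<Longrightarrow> norm (g z) \<le> c"
  shows "weighted_norm q u A g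
    \<le> ennreal c * (\<integral>\<^sup>+x\<in>A. ennreal (u x) \<partial>lebesgue) epowr (1 / q)"
proof -
  note [measurable] = weight_measurable[OF assms(1)] assms(3)
  have "(\<integral>\<^sup>+x\<in>A. ennreal (norm (g x) powr q * u x) \<partial>lebesgue)
      \<le> (\<integral>\<^sup>+x. ennreal (c powr q) * (ennreal (u x) * indicator A x) \<partial>lebesgue)"
    using assms weight_nonneg[OF assms(1)]
    by (intro nn_integral_mono)
      (auto simp: indicator_def intro!: ennreal_leI mult_right_mono powr_mono2 simp flip: ennreal_mult)
  also have "\<dots> = ennreal (c powr q) * (\<integral>\<^sup>+x\<in>A. ennreal (u x) \<partial>lebesgue)"
    by (intro nn_integral_cmult) measurable
  finally have "weighted_norm q u A g
      \<le> (ennreal (c powr q) * (\<integral>\<^sup>+x\<in>A. ennreal (u x) \<partial>lebesgue)) epowr (1 / q)"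
    unfolding weighted_norm_def using assms by (intro epowr_mono) auto
  also have "\<dots> = ennreal c * (\<integral>\<^sup>+x\<in>A. ennreal (u x) \<partial>lebesgue) epowr (1 / q)"
    using assms by (simp add: mult_epowr epowr_ennreal powr_powr)
  finally show ?thesis .
qed

lemma const_le_weighted_norm:
  assumes "weight u" "0 < q" "A \<in> sets lebesgue" "0 \<le> c" "\<And>z. z \<in> A \<Longrightarrow> c \<le> norm (g z)"
  shows "ennreal c * (\<integral>\<^sup>+x\<in>A. ennreal (u x) \<partial>lebesgue) epowr (1 / q)
    \<le> weighted_norm q u A g"
proof -
  note [measurable] = weight_measurable[OF assms(1)] assms(3)
  have "ennreal c * (\<integral>\<^sup>+x\<in>A. ennreal (u x) \<partial>lebesgue) epowr (1 / q)
      = (ennreal (c powr q) * (\<integral>\<^sup>+x\<in>A. ennreal (u x) \<partial>lebesgue)) epowr (1 / q)"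
    using assms by (simp add: mult_epowr epowr_ennreal powr_powr)
  also have "\<dots> = (\<integral>\<^sup>+x. ennreal (c powr q) * (ennreal (u x) * indicator A x) \<partial>lebesgue) epowr (1 / q)"
    by (subst nn_integral_cmult) measurable
  also have "\<dots> \<le> weighted_norm q u A g"
    unfolding weighted_norm_def using assms weight_nonneg[OF assms(1)]
    by (intro epowr_mono nn_integral_mono)
      (auto simp: indicator_def intro!: ennreal_leI mult_right_mono powr_mono2 simp flip: ennreal_mult)
  finally show ?thesis .
qed

section \<open>Upper and lower bounds for the transform of a localized function\<close>

lemma norm_fourier_le: "norm (fourier f z) \<le> (LINT x|lebesgue. norm (f x))"
proof -
  have "norm (fourier f z)
      \<le> (LINT x|lebesgue. norm (f x * exp (- \<i> * complex_of_real (x \<bullet> z))))"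
    unfolding fourier_def by (rule integral_norm_bound)
  then show ?thesis
    by (simp add: norm_mult)
qed

lemma integrable_mult_cis:
  fixes f :: "real ^ 'n \<Rightarrow> real"
  assumes "integrable lebesgue f" "continuous_on UNIV \<theta>"
  shows "integrable lebesgue (\<lambda>x. complex_of_real (f x) * cis (\<theta> x))"
proof (rule Bochner_Integration.integrable_bound[OF assms(1)])
  have "(\<lambda>x. cis (\<theta> x)) \<in> borel_measurable borel"
    using assms(2) unfolding cis_conv_exp
    by (intro borel_measurable_continuous_onI continuous_intros)
  then have "(\<lambda>x. cis (\<theta> x)) \<in> borel_measurable lebesgue"
    by (simp add: measurable_completion)
  then show "(\<lambda>x. complex_of_real (f x) * cis (\<theta> x)) \<in> borel_measurable lebesgue"
    using assms(1) by (intro borel_measurable_times borel_measurable_of_real) auto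
qed (simp add: norm_mult)

text \<open>Up to a unimodular constant, \<open>fourier (f e\<^bsup>i x\<cdot>b\<^esup>) z\<close> is the integral of
  \<open>f x e\<^bsup>-i (x - a)\<cdot>(z - b)\<^esup>\<close>, whose phase stays in \<open>[-1, 1]\<close> on the support of \<open>f\<close>.\<close>

lemma norm_fourier_modulated_ge:
  fixes f :: "real ^ 'n \<Rightarrow> real"
  assumes f: "\<And>x. 0 \<le> f x" "integrable lebesgue f" "supported_in f A"
    and phase: "\<And>x. x \<in> A \<Longrightarrow> \<bar>(x - a) \<bullet> (z - b)\<bar> \<le> 1"
  shows "cos 1 * (LINT x|lebesgue. f x)
    \<le> norm (fourier (\<lambda>x. complex_of_real (f x) * cis (x \<bullet> b)) z)"
proof -
  let ?g = "\<lambda>x. complex_of_real (f x) * cis (- ((x - a) \<bullet> (z - b)))"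
  have int: "integrable lebesgue ?g"
    by (intro integrable_mult_cis f continuous_intros)
  have "AE x in lebesgue. cos 1 * f x \<le> Re (?g x)"
    using f(3) unfolding supported_in_def
  proof (rule eventually_mono)
    fix x
    assume *: "x \<notin> A \<longrightarrow> f x = 0"
    show "cos 1 * f x \<le> Re (?g x)"
    proof (cases "f x = 0")
      case False
      then have "\<bar>(x - a) \<bullet> (z - b)\<bar> \<le> 1"
        using * phase by blast
      \<comment> \<open>Cosine is even and decreasing on [0, \<pi>], so it is at least cos 1 for
        phases in [-1, 1].\<close>
      then have "cos 1 \<le> cos \<bar>(x - a) \<bullet> (z - b)\<bar>"
        using pi_gt3 by (intro cos_monotone_0_pi_le) auto
      then show ?thesis
        using f(1)[of x] by (simp add: mult.commute[of "f x"] mult_right_mono)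
    qed simp
  qed
  then have "(LINT x|lebesgue. cos 1 * f x) \<le> (LINT x|lebesgue. Re (?g x))"
    using f(2) integrable_Re[OF int] by (intro integral_mono_AE) auto
  also have "\<dots> = Re (LINT x|lebesgue. ?g x)"
    using int by (rule integral_Re)
  also have "\<dots> \<le> norm (LINT x|lebesgue. ?g x)"
    by (rule complex_Re_le_cmod)
  \<comment> \<open>The factor depending on \<open>a\<close> does not involve the integration
    variable; it is pulled out and has modulus one.\<close>
  also have "\<dots> = norm (cis (a \<bullet> (z - b)) * (LINT x|lebesgue.
      complex_of_real (f x) * cis (x \<bullet> b) * exp (- \<i> * complex_of_real (x \<bullet> z))))"
    unfolding integral_mult_right_zero[symmetric]
    by (intro arg_cong[where f = norm] Bochner_Integration.integral_cong)
      (auto simp: cis_conv_exp algebra_simps inner_diff_left inner_diff_right simp flip: exp_add)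
  also have "\<dots> = norm (fourier (\<lambda>x. complex_of_real (f x) * cis (x \<bullet> b)) z)"
    by (simp add: norm_mult fourier_def)
  finally show ?thesis by simp
qed

text \<open>Test the Fourier inequality on \<open>f\<close> modulated by the frequency
  \<open>b\<close>, the centre for \<open>B\<close>. The modulus of the function stays
  \<open>f\<close>, while its transform is bounded below on \<open>B\<close>. The sets enter
  symmetrically, so both halves of the mean inequality are instances.\<close>

lemma fourier_ineq_imp_mean:
  fixes f :: "real ^ 'n \<Rightarrow> real"
  assumes u: "weight u" and q: "0 < q" and C: "0 \<le> C"
    and ineq: "\<And>f :: real ^ 'n \<Rightarrow> complex. integrable lebesgue f \<Longrightarrow>
      weighted_norm q u UNIV (fourier f) \<le> ennreal C * weighted_norm p v UNIV f"
    and B: "B \<in> sets lebesgue"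
    and phase: "\<And>x z. x \<in> A \<Longrightarrow> z \<in> B \<Longrightarrow> \<bar>(x - a) \<bullet> (z - b)\<bar> \<le> 1"
    and f: "\<And>x. 0 \<le> f x" "integrable lebesgue f" "supported_in f A"
  shows "(\<integral>\<^sup>+x\<in>A. ennreal (f x) \<partial>lebesgue) * (\<integral>\<^sup>+x\<in>B. ennreal (u x) \<partial>lebesgue) epowr (1 / q)
    \<le> ennreal (C / cos 1) * (\<integral>\<^sup>+x\<in>A. ennreal (f x powr p * v x) \<partial>lebesgue) epowr (1 / p)"
proof -
  let ?F = "\<lambda>x. complex_of_real (f x) * cis (x \<bullet> b)"
  let ?I = "LINT x|lebesgue. f x"
  let ?U = "(\<integral>\<^sup>+x\<in>B. ennreal (u x) \<partial>lebesgue) epowr (1 / q)"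
  \<comment> \<open>Positivity holds because 1 < \<pi> / 2; it allows the final division by cos
    1.\<close>
  have cos1: "0 < cos (1::real)"
    using pi_gt3 by (intro cos_gt_zero_pi) auto
  have I: "0 \<le> ?I"
    using f(1) by (simp add: integral_nonneg_AE)
  have "(\<integral>\<^sup>+x\<in>A. ennreal (f x) \<partial>lebesgue) = (\<integral>\<^sup>+x. ennreal (f x) \<partial>lebesgue)"
    by (rule nn_integral_supported_in[OF f(3)]) simp
  also have "\<dots> = ennreal ?I"
    using f by (intro nn_integral_eq_integral) auto
  finally have eqI: "(\<integral>\<^sup>+x\<in>A. ennreal (f x) \<partial>lebesgue) = ennreal ?I" .
  have F: "supported_in ?F A"
    using f(3) by (auto simp: supported_in_def)
  have intF: "integrable lebesgue ?F"
    by (intro integrable_mult_cis f continuous_intros)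
  have "ennreal (cos 1 * ?I) * ?U \<le> weighted_norm q u B (fourier ?F)"
    using cos1 I by (intro const_le_weighted_norm u q B norm_fourier_modulated_ge[of f A a] f phase) auto
  also have "\<dots> \<le> weighted_norm q u UNIV (fourier ?F)"
    using q by (intro weighted_norm_mono_set) auto
  also have "\<dots> \<le> ennreal C * weighted_norm p v UNIV ?F"
    by (rule ineq[OF intF])
  also have "weighted_norm p v UNIV ?F
      = (\<integral>\<^sup>+x\<in>A. ennreal (f x powr p * v x) \<partial>lebesgue) epowr (1 / p)" (is "_ = ?N")
    unfolding weighted_norm_supported_in[OF F] using f(1) by (simp add: weighted_norm_def norm_mult)
  finally have *: "ennreal (cos 1 * ?I) * ?U \<le> ennreal C * ?N" .
  have "ennreal ?I * ?U = ennreal (1 / cos 1) * (ennreal (cos 1 * ?I) * ?U)"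
    using cos1 I by (simp add: mult.assoc[symmetric] flip: ennreal_mult)
  also have "\<dots> \<le> ennreal (1 / cos 1) * (ennreal C * ?N)"
    by (rule mult_left_mono[OF *]) simp
  also have "\<dots> = ennreal (C / cos 1) * ?N"
    using cos1 C by (simp add: mult.assoc[symmetric] flip: ennreal_mult)
  finally show ?thesis
    by (simp add: eqI)
qed

text \<open>The transform is bounded everywhere by the integral of |f|, so its norm over
  \<open>B\<close> is at most that integral times the u-factor of \<open>B\<close>; the mean
  inequality for |f| finishes.\<close>

lemma mean_imp_fourier:
  fixes f :: "real ^ 'n \<Rightarrow> complex"
  assumes u: "weight u" and q: "0 < q"
    and ineq: "\<And>f :: real ^ 'n \<Rightarrow> real.
      (\<forall>x. 0 \<le> f x) \<and> integrable lebesgue f \<and> supported_in f A \<Longrightarrow>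
      (\<integral>\<^sup>+x\<in>A. ennreal (f x) \<partial>lebesgue) * (\<integral>\<^sup>+x\<in>B. ennreal (u x) \<partial>lebesgue) epowr (1 / q)
      \<le> ennreal C * (\<integral>\<^sup>+x\<in>A. ennreal (f x powr p * v x) \<partial>lebesgue) epowr (1 / p)"
    and B: "B \<in> sets lebesgue"
    and f: "integrable lebesgue f" "supported_in f A"
  shows "weighted_norm q u B (fourier f) \<le> ennreal C * weighted_norm p v A f"
proof -
  let ?I = "LINT x|lebesgue. norm (f x)"
  have "(\<integral>\<^sup>+x\<in>A. ennreal (norm (f x)) \<partial>lebesgue) = (\<integral>\<^sup>+x. ennreal (norm (f x)) \<partial>lebesgue)"
    by (rule nn_integral_supported_in[OF f(2)]) simp
  also have "\<dots> = ennreal ?I"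
    using f by (intro nn_integral_eq_integral) auto
  finally have eqI: "(\<integral>\<^sup>+x\<in>A. ennreal (norm (f x)) \<partial>lebesgue) = ennreal ?I" .
  have "weighted_norm q u B (fourier f)
      \<le> ennreal ?I * (\<integral>\<^sup>+x\<in>B. ennreal (u x) \<partial>lebesgue) epowr (1 / q)"
    by (intro weighted_norm_le_const u q B norm_fourier_le) (simp add: integral_nonneg_AE)
  also have "\<dots> \<le> ennreal C
      * (\<integral>\<^sup>+x\<in>A. ennreal (norm (f x) powr p * v x) \<partial>lebesgue) epowr (1 / p)"
    unfolding eqI[symmetric] using f by (intro ineq) (auto simp: supported_in_def)
  finally show ?thesis
    by (simp add: weighted_norm_def)
qed

section \<open>The four conditions\<close>

text \<open>Shrinking the set only decreases the left side, and the support condition makes the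
  global right side equal to the local one.\<close>

lemma fourier_ineq_imp_local_fourier_ineq:
  fixes u v :: "real ^ 'n \<Rightarrow> real"
  assumes "0 < q" "fourier_ineq p q u v"
  shows "local_fourier_ineq p q u v"
proof -
  obtain C where C: "0 \<le> C" and ineq: "\<And>f. integrable lebesgue f \<Longrightarrow>
      weighted_norm q u UNIV (fourier f) \<le> ennreal C * weighted_norm p v UNIV f"
    using assms(2) unfolding fourier_ineq_def by blast
  have "weighted_norm q u B (fourier f) \<le> ennreal C * weighted_norm p v A f"
    if "integrable lebesgue f" "supported_in f A" for A B and f :: "real ^ 'n \<Rightarrow> complex"
    using weighted_norm_mono_set[of B UNIV q u "fourier f"] ineq[OF that(1)] assms(1)
    by (simp add: weighted_norm_supported_in[OF that(2)])
  then show ?thesis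
    unfolding local_fourier_ineq_def using C by blast
qed

lemma fourier_ineq_imp_mean_ineq:
  fixes u v :: "real ^ 'n \<Rightarrow> real"
  assumes "0 < q" "weight u" "fourier_ineq p q u v"
  shows "mean_ineq p q u v"
proof -
  obtain C where C: "0 \<le> C" and ineq: "\<And>f. integrable lebesgue f \<Longrightarrow>
      weighted_norm q u UNIV (fourier f) \<le> ennreal C * weighted_norm p v UNIV f"
    using assms(3) unfolding fourier_ineq_def by blast
  have "0 < cos (1::real)"
    using pi_gt3 by (intro cos_gt_zero_pi) auto
  then have "0 \<le> C / cos 1"
    using C by simp
  note mean = fourier_ineq_imp_mean[OF assms(2,1) C ineq]
  show ?thesis
    unfolding mean_ineq_def
  proof (intro exI[of _ "C / cos 1"] conjI allI impI; (elim conjE)?)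
    show "0 \<le> C / cos 1" by fact
  next
    fix E and \<mu> \<tau> :: "real ^ 'n" and f :: "real ^ 'n \<Rightarrow> real"
    assume "\<forall>x. 0 \<le> f x" "integrable lebesgue f" "supported_in f E"
    then show "(\<integral>\<^sup>+x\<in>E. ennreal (f x) \<partial>lebesgue)
          * (\<integral>\<^sup>+x\<in>polar_translate E \<mu> \<tau>. ennreal (u x) \<partial>lebesgue) epowr (1 / q)
        \<le> ennreal (C / cos 1) * (\<integral>\<^sup>+x\<in>E. ennreal (f x powr p * v x) \<partial>lebesgue) epowr (1 / p)"
      by (intro mean[of _ E "- \<mu>" \<tau>] polar_translate_sets polar_translate_inner_le) auto
  next
    fix E and \<mu> \<tau> :: "real ^ 'n" and f :: "real ^ 'n \<Rightarrow> real"
    assume "E \<in> sets lebesgue" "\<forall>x. 0 \<le> f x" "integrable lebesgue f"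
      "supported_in f (polar_translate E \<mu> \<tau>)"
    \<comment> \<open>The sets are exchanged here: \<tau> becomes the centre for the functions and
      \<open>- \<mu>\<close> the modulation frequency.\<close>
    moreover have "\<bar>(x - \<tau>) \<bullet> (z - (- \<mu>))\<bar> \<le> 1"
      if "x \<in> polar_translate E \<mu> \<tau>" "z \<in> E" for x z
      using polar_translate_inner_le[OF that(2,1)] by (simp add: inner_commute)
    ultimately show "(\<integral>\<^sup>+x\<in>polar_translate E \<mu> \<tau>. ennreal (f x) \<partial>lebesgue)
          * (\<integral>\<^sup>+x\<in>E. ennreal (u x) \<partial>lebesgue) epowr (1 / q)
        \<le> ennreal (C / cos 1)
          * (\<integral>\<^sup>+x\<in>polar_translate E \<mu> \<tau>. ennreal (f x powr p * v x) \<partial>lebesgue) epowr (1 / p)"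
      by (intro mean[of _ _ \<tau> "- \<mu>"]) auto
  qed
qed

text \<open>Each half is the equivalence for a single set, with \<open>K\<close> the u-factor of the
  other set. Because that equivalence keeps \<open>C\<close>, it can be applied underneath the
  quantifiers.\<close>

lemma mean_ineq_iff_muckenhoupt_polar:
  fixes u v :: "real ^ 'n \<Rightarrow> real"
  assumes "1 < p" "weight v" "locally_integrable (dual_weight p v)"
  shows "mean_ineq p q u v \<longleftrightarrow> muckenhoupt_polar p q u v"
  unfolding mean_ineq_def muckenhoupt_polar_def
  by (intro arg_cong[where f = Ex] ext conj_cong refl all_cong1 imp_cong
      mean_ineq_iff_dual_weight[OF assms] polar_translate_sets) simp_all

lemma mean_ineq_imp_local_fourier_ineq:
  fixes u v :: "real ^ 'n \<Rightarrow> real"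
  assumes "0 < q" "weight u" "mean_ineq p q u v"
  shows "local_fourier_ineq p q u v"
proof -
  from assms(3)[unfolded mean_ineq_def] show ?thesis
  proof (elim exE conjE, goal_cases)
    case (1 C)
    note mean = 1(2)[THEN spec, THEN spec, THEN spec, THEN mp]
    show ?case
      unfolding local_fourier_ineq_def
    proof (intro exI[of _ C] conjI allI impI 1(1))
      fix E and \<mu> \<tau> :: "real ^ 'n" and f :: "real ^ 'n \<Rightarrow> complex"
      assume E: "bounded E \<and> E \<in> sets lebesgue \<and> - \<mu> \<in> E"
        and f: "integrable lebesgue f \<and> supported_in f E"
      show "weighted_norm q u (polar_translate E \<mu> \<tau>) (fourier f)
          \<le> ennreal C * weighted_norm p v E f"
        using f by (intro mean_imp_fourier[OF assms(2,1)]
          mean[OF E, THEN conjunct1, THEN spec, THEN mp] polar_translate_sets) auto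
    next
      fix E and \<mu> \<tau> :: "real ^ 'n" and f :: "real ^ 'n \<Rightarrow> complex"
      assume E: "bounded E \<and> E \<in> sets lebesgue \<and> - \<mu> \<in> E"
        and f: "integrable lebesgue f \<and> supported_in f (polar_translate E \<mu> \<tau>)"
      show "weighted_norm q u E (fourier f)
          \<le> ennreal C * weighted_norm p v (polar_translate E \<mu> \<tau>) f"
        using E f by (intro mean_imp_fourier[OF assms(2,1)]
          mean[OF E, THEN conjunct2, THEN spec, THEN mp]) auto
    qed
  qed
qed

theorem theorem1:
  fixes p q :: real and u v :: "real ^ 'n \<Rightarrow> real"
  assumes "1 < p" and "1 < q"
    and "weight u" and "weight v"
    and "locally_integrable (dual_weight p v)"
  shows "(fourier_ineq p q u v \<longrightarrow> local_fourier_ineq p q u v) \<and>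
         (fourier_ineq p q u v \<longrightarrow> mean_ineq p q u v) \<and>
         (mean_ineq p q u v \<longleftrightarrow> muckenhoupt_polar p q u v) \<and>
         (muckenhoupt_polar p q u v \<longrightarrow> local_fourier_ineq p q u v)"
proof -
  have "0 < q"
    using assms(2) by simp
  then show ?thesis
    using fourier_ineq_imp_local_fourier_ineq fourier_ineq_imp_mean_ineq[OF _ assms(3)]
      mean_ineq_iff_muckenhoupt_polar[OF assms(1,4,5)]
      mean_ineq_imp_local_fourier_ineq[OF _ assms(3)]
    by blast
qed

end
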